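(* Fix $\delta,\rho\in(0,1)$. There exist $\nu_i=\nu_i(\delta,\rho)>0$ for $i\in\{1,2,3\}$, and there is a family $\mathcal{R}_{\delta,\rho}$, of size $m_{\delta,\rho}$ (a number depending only on $\delta,\rho$), of pairs $(\sigma,S)\in\mathfrak{S}_{[N]}\times\binom{[N]}{N/2}$ such that the following holds with $\nu=(\nu_1,\nu_2,\nu_3)$: for any $w,v\in\mathrm{Incomp}^0_{\delta,\rho}$ there is $(\sigma,S)\in\mathcal{R}_{\delta,\rho}$ such that $\mathcal{I}_\nu(w,\sigma)$ and $\mathcal{J}_\nu(v,S)$ hold.
   Context: $N$ is a positive integer (the dimension); $[N]=\{1,\dots,N\}$; $\mathfrak{S}_{[N]}$ is the set of permutations of $[N]$; $\binom{[N]}{N/2}$ is the set of subsets of $[N]$ of size $N/2$ (floors and ceilings are omitted); $\mathbb{S}^{N-1}$ is the Euclidean unit sphere in $\mathbb{R}^N$. For $\delta,\rho\in(0,1)$, $\mathrm{Comp}_{\delta,\rho}$ is the set of $v\in\mathbb{S}^{N-1}$ within Euclidean distance $\rho$ of some vector in $\mathbb{R}^N$ with at most $\delta N$ non-zero coordinates, $\mathrm{Incomp}_{\delta,\rho}=\mathbb{S}^{N-1}\setminus\mathrm{Comp}_{\delta,\rho}$, and $\mathrm{Incomp}^0_{\delta,\rho}$ is the set of $v\in\mathrm{Incomp}_{\delta,\rho}$ with $\sum_i v_i=0$. For $w\in\mathbb{S}^{N-1}$, $\sigma\in\mathfrak{S}_{[N]}$: $\mathcal{I}_\nu(w,\sigma)$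 holds if there are at least $\nu_1N$ indices $i\in[N-1]$ with $|w_{\sigma(i)}-w_{\sigma(i+1)}|\sqrt{N}\ge\nu_2$. For $v\in\mathbb{S}^{N-1}$, $S\subseteq[N]$ (with $S^c=[N]\setminus S$): $\mathcal{J}_\nu(v,S)$ holds if (1) there are at least $\nu_1N$ indices $i\in S$ and at least $\nu_1N$ indices $j\in S^c$ with $v_i\sqrt N,\,v_j\sqrt N\in[\nu_2,\nu_3]$, and (2) there are at least $\nu_1N$ indices $i\in S$ and at least $\nu_1N$ indices $j\in S^c$ with $v_i\sqrt N,\,v_j\sqrt N\in[-\nu_3,-\nu_2]$.
   Formalization: The claim is proved for all N at least some threshold N_0(δ,ρ), not for every positive N; as written it fails, e.g. for N=2, δ<1/2 and v=(1,-1)/√2, which lies in Incomp^0 but has only one positive entry, so J_ν(v,S) fails for every S. *)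

theory Defs
  imports "HOL-Analysis.L2_Norm" "HOL-Combinatorics.Permutations" "HOL-Library.FuncSet"
begin

text \<open>The dimension \<open>N\<close> varies inside the statement (constants are uniform in it), so vectors of
  \<open>\<real>\<^sup>N\<close> are extensional functions on the index set \<open>{1..N}\<close>.\<close>

definition vecs :: "nat \<Rightarrow> (nat \<Rightarrow> real) set" where
  "vecs N = {1..N} \<rightarrow>\<^sub>E UNIV"

definition unit_sphere :: "nat \<Rightarrow> (nat \<Rightarrow> real) set" where
  "unit_sphere N = {v \<in> vecs N. L2_set v {1..N} = 1}"

definition Comp :: "nat \<Rightarrow> real \<Rightarrow> real \<Rightarrow> (nat \<Rightarrow> real) set" where
  "Comp N \<delta> \<rho> = {v \<in> unit_sphere N. \<exists>u \<in> vecs N.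
     real (card {i \<in> {1..N}. u i \<noteq> 0}) \<le> \<delta> * real N \<and>
     L2_set (\<lambda>i. v i - u i) {1..N} \<le> \<rho>}"

definition Incomp :: "nat \<Rightarrow> real \<Rightarrow> real \<Rightarrow> (nat \<Rightarrow> real) set" where
  "Incomp N \<delta> \<rho> = unit_sphere N - Comp N \<delta> \<rho>"

definition Incomp0 :: "nat \<Rightarrow> real \<Rightarrow> real \<Rightarrow> (nat \<Rightarrow> real) set" where
  "Incomp0 N \<delta> \<rho> = {v \<in> Incomp N \<delta> \<rho>. (\<Sum>i\<in>{1..N}. v i) = 0}"

definition perms :: "nat \<Rightarrow> (nat \<Rightarrow> nat) set" where
  "perms N = {\<sigma>. \<sigma> permutes {1..N}}"

text \<open>For odd \<open>N\<close> the size \<open>N/2\<close> is rounded down.\<close>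

definition half_subsets :: "nat \<Rightarrow> nat set set" where
  "half_subsets N = {S. S \<subseteq> {1..N} \<and> card S = N div 2}"

text \<open>The event \<open>\<I>\<^sub>\<nu>(w,\<sigma>)\<close>; it does not involve \<open>\<nu>\<^sub>3\<close>.\<close>

definition I_event :: "nat \<Rightarrow> real \<Rightarrow> real \<Rightarrow> (nat \<Rightarrow> real) \<Rightarrow> (nat \<Rightarrow> nat) \<Rightarrow> bool" where
  "I_event N \<nu>1 \<nu>2 w \<sigma> \<longleftrightarrow>
     real (card {i \<in> {1..N-1}. \<bar>w (\<sigma> i) - w (\<sigma> (i+1))\<bar> * sqrt (real N) \<ge> \<nu>2}) \<ge> \<nu>1 * real N"

definition J_event :: "nat \<Rightarrow> real \<Rightarrow> real \<Rightarrow> real \<Rightarrow> (nat \<Rightarrow> real) \<Rightarrow> nat set \<Rightarrow> bool" where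
  "J_event N \<nu>1 \<nu>2 \<nu>3 v S \<longleftrightarrow>
     real (card {i \<in> S. v i * sqrt (real N) \<in> {\<nu>2..\<nu>3}}) \<ge> \<nu>1 * real N \<and>
     real (card {j \<in> {1..N} - S. v j * sqrt (real N) \<in> {\<nu>2..\<nu>3}}) \<ge> \<nu>1 * real N \<and>
     real (card {i \<in> S. v i * sqrt (real N) \<in> {-\<nu>3..-\<nu>2}}) \<ge> \<nu>1 * real N \<and>
     real (card {j \<in> {1..N} - S. v j * sqrt (real N) \<in> {-\<nu>3..-\<nu>2}}) \<ge> \<nu>1 * real N"

end

theory Submission
  imports Defs
begin

text \<open>An incompressible vector has \<open>\<ell>\<^sup>1\<close>-norm at least \<open>\<delta>\<rho> \<surd>N\<close>; as its entries sum to zero, half of this mass is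
  positive and half negative, and Markov-type bounds show that it has linearly many entries
  \<open>v\<^sub>i \<surd>N\<close> in \<open>[c/8, 8/c]\<close> and in \<open>[-8/c, -c/8]\<close>, where \<open>c = \<delta>\<rho>\<close>.
  It remains to find boundedly many half-sets splitting any two linear-size sets, and boundedly many
  bijections between the two halves of \<open>[N]\<close> one of which has linearly many edges between any linear-size
  subsets of the halves. A random half-set misses (or contains) a fixed linear-size set, and a random
  bijection has no edge between two of them, with probability \<open>e\<^sup>-\<^sup>\<Omega>\<^sup>(\<^sup>N\<^sup>)\<close>, so boundedly many samples beat the
  at most \<open>4\<^sup>N\<close> pairs of sets. Deleting the small intersections from the given sets upgrades
  ``nonempty'' to ``of linear size''.\<close>

section \<open>Covering all tests by boundedly many samples\<close>

text \<open>Greedy form of independent sampling: by averaging, some \<open>\<omega>\<close> is bad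
  for at most a \<open>q\<close>-fraction of the tests still uncovered. Adding it to
  \<open>F\<close> and repeating \<open>m\<close> times leaves at most a
  \<open>q ^ m\<close>-fraction. The same sample may be chosen twice, hence only
  \<open>card F \<le> m\<close>.\<close>

lemma greedy_cover:
  fixes \<Omega> :: "'a set" and T :: "'b set" and P :: "'b \<Rightarrow> 'a \<Rightarrow> bool" and q :: real
  assumes fin: "finite \<Omega>" "\<Omega> \<noteq> {}" "finite T" and q: "0 \<le> q"
    and bad: "\<And>t. t \<in> T \<Longrightarrow> real (card {\<omega> \<in> \<Omega>. P t \<omega>}) \<le> q * real (card \<Omega>)"
  shows "\<exists>F \<subseteq> \<Omega>. finite F \<and> card F \<le> m \<and> real (card {t \<in> T. \<forall>\<omega>\<in>F. P t \<omega>}) \<le> q ^ m * real (card T)"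
proof (induction m)
  case 0
  show ?case by (rule exI[of _ "{}"]) simp
next
  case (Suc m)
  then obtain F where F: "F \<subseteq> \<Omega>" "finite F" "card F \<le> m"
    "real (card {t \<in> T. \<forall>\<omega>\<in>F. P t \<omega>}) \<le> q ^ m * real (card T)" by blast
  define T' where "T' = {t \<in> T. \<forall>\<omega>\<in>F. P t \<omega>}"
  have finT': "finite T'" and T'T: "T' \<subseteq> T" using fin(3) by (auto simp: T'_def)
  \<comment> \<open>Double counting of the bad pairs in \<open>T' \<times> \<Omega>\<close>: if
    every \<open>\<omega>\<close> exceeded its share, so would the total, against the bound
    \<open>bad\<close> for each \<open>t\<close>.\<close>
  have "\<exists>\<omega>\<in>\<Omega>. real (card {t \<in> T'. P t \<omega>}) \<le> q * real (card T')"
  proof (rule ccontr)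
    assume "\<not> ?thesis"
    then have "(\<Sum>\<omega>\<in>\<Omega>. q * real (card T')) < (\<Sum>\<omega>\<in>\<Omega>. real (card {t \<in> T'. P t \<omega>}))"
      using fin(1,2) by (intro sum_strict_mono) (auto simp: not_le)
    also have "\<dots> = real (\<Sum>\<omega>\<in>\<Omega>. \<Sum>t\<in>T'. if P t \<omega> then 1 else 0)"
      using finT' by (simp add: sum.If_cases Int_def)
    also have "\<dots> = real (\<Sum>t\<in>T'. \<Sum>\<omega>\<in>\<Omega>. if P t \<omega> then 1 else 0)"
      by (subst sum.swap) simp
    also have "\<dots> = (\<Sum>t\<in>T'. real (card {\<omega>\<in>\<Omega>. P t \<omega>}))"
      using fin(1) by (simp add: sum.If_cases Int_def)
    also have "\<dots> \<le> (\<Sum>t\<in>T'. q * real (card \<Omega>))"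
      using bad T'T by (intro sum_mono) auto
    finally show False by (simp add: mult_ac)
  qed
  then obtain \<omega> where \<omega>: "\<omega> \<in> \<Omega>" "real (card {t \<in> T'. P t \<omega>}) \<le> q * real (card T')" by blast
  have "{t \<in> T. \<forall>\<omega>\<in>insert \<omega> F. P t \<omega>} = {t \<in> T'. P t \<omega>}" by (auto simp: T'_def)
  then have "real (card {t \<in> T. \<forall>\<omega>\<in>insert \<omega> F. P t \<omega>}) \<le> q * real (card T')" using \<omega>(2) by simp
  also have "\<dots> \<le> q * (q ^ m * real (card T))"
    using F(4) q by (intro mult_left_mono) (auto simp: T'_def)
  finally show ?case
    using F \<omega>(1) by (intro exI[of _ "insert \<omega> F"]) (auto simp: card_insert_if mult_ac)
qed

text \<open>The number of tests failed by every chosen sample is an integer below 1, hence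
  zero.\<close>

lemma probabilistic_cover:
  fixes \<Omega> :: "'a set" and T :: "'b set" and P :: "'b \<Rightarrow> 'a \<Rightarrow> bool" and q :: real
  assumes fin: "finite \<Omega>" "\<Omega> \<noteq> {}" "finite T" and q: "0 \<le> q"
    and bad: "\<And>t. t \<in> T \<Longrightarrow> real (card {\<omega> \<in> \<Omega>. P t \<omega>}) \<le> q * real (card \<Omega>)"
    and small: "q ^ m * real (card T) < 1"
  obtains F where "F \<subseteq> \<Omega>" "finite F" "card F \<le> m" "\<forall>t\<in>T. \<exists>\<omega>\<in>F. \<not> P t \<omega>"
proof -
  have "\<exists>F \<subseteq> \<Omega>. finite F \<and> card F \<le> m \<and> real (card {t \<in> T. \<forall>\<omega>\<in>F. P t \<omega>}) \<le> q ^ m * real (card T)"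
    by (rule greedy_cover[OF fin q bad])
  then obtain F where F: "F \<subseteq> \<Omega>" "finite F" "card F \<le> m"
    "real (card {t \<in> T. \<forall>\<omega>\<in>F. P t \<omega>}) \<le> q ^ m * real (card T)" by blast
  have "card {t \<in> T. \<forall>\<omega>\<in>F. P t \<omega>} = 0" using F(4) small by linarith
  then have "{t \<in> T. \<forall>\<omega>\<in>F. P t \<omega>} = {}" using fin(3) by simp
  with that[OF F(1-3)] show ?thesis by blast
qed

section \<open>Counting subsets and permutations that avoid a given set\<close>

text \<open>Bounds the chance that a random \<open>a\<close>-subset of \<open>n\<close> points
  misses \<open>b\<close> fixed ones. The quotient of the binomials is a product of \<open>a\<close>
  factors \<open>(n - b - i) / (n - i)\<close>, each at most
  \<open>1 - \<kappa> \<le> exp (- \<kappa>)\<close>.\<close>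

lemma binomial_diff_le_exp:
  fixes \<kappa> :: real
  assumes "b \<le> n" "\<kappa> * real n \<le> real b" "0 \<le> \<kappa>"
  shows "real ((n - b) choose a) \<le> exp (- \<kappa> * real a) * real (n choose a)"
\<comment> \<open>The product formula needs \<open>a \<le> n - b\<close>; beyond that the left side
  is 0, and \<open>n = 0\<close> is immediate.\<close>
proof (cases "a \<le> n - b \<and> n > 0")
  case False
  then show ?thesis
  proof (cases "n = 0")
    case True
    then show ?thesis by (cases a) auto
  qed (use False in \<open>auto simp: binomial_eq_0\<close>)
next
  case True
  then have an: "a \<le> n - b" "0 < n" by auto
  have "real ((n - b) choose a) = (\<Prod>i<a. real (n - b - i) / real (a - i))"
    using an binomial_altdef_of_nat[of a "n - b", where ?'a = real] by (simp add: atLeast0LessThan)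
  also have "\<dots> \<le> (\<Prod>i<a. exp (- \<kappa>) * (real (n - i) / real (a - i)))"
  proof (intro prod_mono conjI)
    fix i assume i: "i \<in> {..<a}"
    have "real (n - b - i) = real n - real b - real i" using i an by (simp add: of_nat_diff)
    also have "\<dots> \<le> real n - real i - \<kappa> * real n" using assms by simp
    also have "\<dots> \<le> (1 - \<kappa>) * (real n - real i)" using assms by (simp add: algebra_simps)
    also have "\<dots> \<le> exp (- \<kappa>) * (real n - real i)"
      using exp_ge_add_one_self[of "- \<kappa>"] i an by (intro mult_right_mono) auto
    also have "\<dots> = exp (- \<kappa>) * real (n - i)" using i an by (simp add: of_nat_diff)
    finally show "real (n - b - i) / real (a - i) \<le> exp (- \<kappa>) * (real (n - i) / real (a - i))"
      by (simp add: divide_right_mono)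
  qed auto
  also have "\<dots> = exp (- \<kappa>) ^ a * (\<Prod>i<a. real (n - i) / real (a - i))"
    unfolding prod.distrib by simp
  also have "\<dots> = exp (- \<kappa> * real a) * real (n choose a)"
    using an binomial_altdef_of_nat[of a n, where ?'a = real]
    by (simp add: exp_of_nat_mult[symmetric] atLeast0LessThan mult_ac)
  finally show ?thesis .
qed

lemma card_subsets_disjoint_le:
  fixes \<kappa> :: real
  assumes "finite U" "A \<subseteq> U" "\<kappa> * real (card U) \<le> real (card A)" "0 \<le> \<kappa>"
  shows "real (card {S. S \<subseteq> U \<and> card S = h \<and> S \<inter> A = {}})
    \<le> exp (- \<kappa> * real h) * real (card U choose h)"
proof -
  have "{S. S \<subseteq> U \<and> card S = h \<and> S \<inter> A = {}} = {S. S \<subseteq> U - A \<and> card S = h}" by auto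
  then have "card {S. S \<subseteq> U \<and> card S = h \<and> S \<inter> A = {}} = (card U - card A) choose h"
    using assms finite_subset[OF assms(2,1)] by (simp add: n_subsets card_Diff_subset)
  then show ?thesis
    using binomial_diff_le_exp[OF card_mono[OF assms(1,2)] assms(3,4)] by simp
qed

text \<open>Complementation turns \<open>A \<subseteq> S\<close> into disjointness from
  \<open>A\<close> and the size \<open>h\<close> into \<open>card U - h\<close>.\<close>

lemma card_subsets_superset_le:
  fixes \<kappa> :: real
  assumes "finite U" "A \<subseteq> U" "\<kappa> * real (card U) \<le> real (card A)" "0 \<le> \<kappa>" "h \<le> card U"
  shows "real (card {S. S \<subseteq> U \<and> card S = h \<and> A \<subseteq> S})
    \<le> exp (- \<kappa> * real (card U - h)) * real (card U choose h)"
proof -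
  have "bij_betw (\<lambda>S. U - S) {S. S \<subseteq> U \<and> card S = h \<and> A \<subseteq> S}
          {S. S \<subseteq> U \<and> card S = card U - h \<and> S \<inter> A = {}}"
  proof (rule bij_betw_byWitness[where f' = "\<lambda>S. U - S"])
    show "(\<lambda>S. U - S) ` {S. S \<subseteq> U \<and> card S = h \<and> A \<subseteq> S}
        \<subseteq> {S. S \<subseteq> U \<and> card S = card U - h \<and> S \<inter> A = {}}"
      using assms(1) by (auto simp: card_Diff_subset finite_subset)
    show "(\<lambda>S. U - S) ` {S. S \<subseteq> U \<and> card S = card U - h \<and> S \<inter> A = {}}
        \<subseteq> {S. S \<subseteq> U \<and> card S = h \<and> A \<subseteq> S}"
      using assms by (auto simp: card_Diff_subset finite_subset)
  qed auto
  then have "card {S. S \<subseteq> U \<and> card S = h \<and> A \<subseteq> S}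
      = card {S. S \<subseteq> U \<and> card S = card U - h \<and> S \<inter> A = {}}"
    by (rule bij_betw_same_card)
  then show ?thesis
    using card_subsets_disjoint_le[OF assms(1-4), of "card U - h"] assms(5)
      binomial_symmetric[of h "card U"] by simp
qed

text \<open>Glue a bijection from \<open>X\<close> to \<open>C\<close> with one between the
  complements in \<open>U\<close>.\<close>

lemma permutes_image_eq_obtain:
  assumes "finite U" "X \<subseteq> U" "C \<subseteq> U" "card C = card X"
  obtains \<tau> where "\<tau> permutes U" "\<tau> ` X = C"
proof -
  have fin: "finite X" "finite C" using assms finite_subset by auto
  obtain f where f: "bij_betw f X C" using fin assms(4) by (metis finite_same_card_bij)
  have "card (U - X) = card (U - C)" using assms fin by (simp add: card_Diff_subset)
  then obtain g where g: "bij_betw g (U - X) (U - C)"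
    using assms(1) by (metis finite_same_card_bij finite_Diff)
  define \<tau> where "\<tau> x = (if x \<in> X then f x else if x \<in> U then g x else x)" for x
  have 1: "bij_betw \<tau> X C" using f by (rule bij_betw_cong[THEN iffD1, rotated]) (auto simp: \<tau>_def)
  have 2: "bij_betw \<tau> (U - X) (U - C)"
    using g by (rule bij_betw_cong[THEN iffD1, rotated]) (auto simp: \<tau>_def)
  have "bij_betw \<tau> (X \<union> (U - X)) (C \<union> (U - C))" by (rule bij_betw_combine[OF 1 2]) auto
  moreover have "X \<union> (U - X) = U" "C \<union> (U - C) = U" using assms by auto
  ultimately have "bij_betw \<tau> U U" by simp
  then have "\<tau> permutes U" by (rule bij_imp_permutes) (use assms(2) in \<open>auto simp: \<tau>_def\<close>)
  moreover have "\<tau> ` X = C" using 1 by (simp add: bij_betw_def)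
  ultimately show ?thesis by (rule that)
qed

text \<open>Composition with a permutation taking \<open>X\<close> to \<open>C\<close> matches the
  two sets. Hence the image of \<open>X\<close> under a uniform permutation is uniform among the
  sets of its size.\<close>

lemma card_permutes_image_eq:
  assumes "finite U" "X \<subseteq> U" "C \<subseteq> U" "card C = card X"
  shows "card {\<pi>. \<pi> permutes U \<and> \<pi> ` X = C} = card {\<pi>. \<pi> permutes U \<and> \<pi> ` X = X}"
proof -
  obtain \<tau> where \<tau>: "\<tau> permutes U" "\<tau> ` X = C" using permutes_image_eq_obtain[OF assms] .
  have inv: "inv \<tau> permutes U" using \<tau>(1) by (rule permutes_inv)
  have "inv \<tau> ` C = X" using \<tau> by (metis image_inv_f_f permutes_inj)
  have "bij_betw (\<lambda>\<pi>. \<tau> \<circ> \<pi>) {\<pi>. \<pi> permutes U \<and> \<pi> ` X = X} {\<pi>. \<pi> permutes U \<and> \<pi> ` X = C}"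
  proof (rule bij_betw_byWitness[where f' = "\<lambda>\<pi>. inv \<tau> \<circ> \<pi>"])
    show "(\<lambda>\<pi>. \<tau> \<circ> \<pi>) ` {\<pi>. \<pi> permutes U \<and> \<pi> ` X = X} \<subseteq> {\<pi>. \<pi> permutes U \<and> \<pi> ` X = C}"
      using \<tau> by (intro image_subsetI) (simp add: permutes_compose image_comp[symmetric] del: comp_apply image_comp)
    show "(\<lambda>\<pi>. inv \<tau> \<circ> \<pi>) ` {\<pi>. \<pi> permutes U \<and> \<pi> ` X = C} \<subseteq> {\<pi>. \<pi> permutes U \<and> \<pi> ` X = X}"
      using inv \<open>inv \<tau> ` C = X\<close>
      by (intro image_subsetI) (simp add: permutes_compose image_comp[symmetric] del: comp_apply image_comp)
  qed (use \<tau>(1) in \<open>auto simp: comp_assoc[symmetric] permutes_inv_o\<close>)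
  then show ?thesis by (rule bij_betw_same_card[symmetric])
qed

lemma card_permutes_image_disjoint_le:
  fixes \<kappa> :: real
  assumes "finite U" "X \<subseteq> U" "Y \<subseteq> U" "\<kappa> * real (card U) \<le> real (card Y)" "0 \<le> \<kappa>"
  shows "real (card {\<pi> \<in> {\<pi>. \<pi> permutes U}. \<pi> ` X \<inter> Y = {}})
    \<le> exp (- \<kappa> * real (card X)) * real (card {\<pi>. \<pi> permutes U})"
proof -
  define K where "K = card {\<pi>. \<pi> permutes U \<and> \<pi> ` X = X}"
  \<comment> \<open>Grouping permutations by the image of \<open>X\<close> gives fibres of the
    common size \<open>K\<close>, so the claim reduces to counting \<open>card X\<close>-subsets
    disjoint from \<open>Y\<close>.\<close>
  have fibres: "card {\<pi>. \<pi> permutes U \<and> \<pi> ` X \<in> \<C>} = card \<C> * K"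
    if \<C>: "\<C> \<subseteq> {C. C \<subseteq> U \<and> card C = card X}" for \<C>
  proof -
    have "finite \<C>" using \<C> assms(1) by (auto intro: finite_subset[of _ "Pow U"])
    have "card {\<pi>. \<pi> permutes U \<and> \<pi> ` X \<in> \<C>} = card (\<Union>C\<in>\<C>. {\<pi>. \<pi> permutes U \<and> \<pi> ` X = C})"
      by (rule arg_cong[where f = card]) auto
    also have "\<dots> = (\<Sum>C\<in>\<C>. card {\<pi>. \<pi> permutes U \<and> \<pi> ` X = C})"
      using \<open>finite \<C>\<close> finite_permutations[OF assms(1)]
      by (intro card_UN_disjoint) (auto intro: finite_subset)
    also have "\<dots> = (\<Sum>C\<in>\<C>. K)"
      unfolding K_def using \<C> by (intro sum.cong card_permutes_image_eq assms) auto
    finally show ?thesis by simp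
  qed
  have im: "\<pi> ` X \<subseteq> U \<and> card (\<pi> ` X) = card X" if "\<pi> permutes U" for \<pi>
    using that assms(2) permutes_image[OF that] by (auto simp: card_image permutes_inj_on)
  have "{\<pi> \<in> {\<pi>. \<pi> permutes U}. \<pi> ` X \<inter> Y = {}}
      = {\<pi>. \<pi> permutes U \<and> \<pi> ` X \<in> {C. C \<subseteq> U \<and> card C = card X \<and> C \<inter> Y = {}}}"
    using im by auto
  then have 1: "card {\<pi> \<in> {\<pi>. \<pi> permutes U}. \<pi> ` X \<inter> Y = {}}
      = card {C. C \<subseteq> U \<and> card C = card X \<and> C \<inter> Y = {}} * K"
    using fibres[of "{C. C \<subseteq> U \<and> card C = card X \<and> C \<inter> Y = {}}"] by auto
  have "{\<pi>. \<pi> permutes U} = {\<pi>. \<pi> permutes U \<and> \<pi> ` X \<in> {C. C \<subseteq> U \<and> card C = card X}}"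
    using im by auto
  then have 2: "card {\<pi>. \<pi> permutes U} = (card U choose card X) * K"
    using fibres[OF order_refl] assms(1) by (simp add: n_subsets)
  show ?thesis
    unfolding 1 2 using card_subsets_disjoint_le[OF assms(1,3,4,5), of "card X"]
    by (simp add: mult_right_mono mult.assoc[symmetric])
qed

section \<open>Bounded families with the expanding and splitting properties\<close>

lemma four_less_exp_2: "4 < exp (2::real)"
  using exp_lower_Taylor_quadratic[of "2::real"] by simp

text \<open>There are \<open>4 ^ n < exp (2 * n)\<close> pairs of subsets, so a failure rate
  \<open>exp (- c * n)\<close> per sample is beaten by a number \<open>m\<close> of samples that
  does not depend on \<open>n\<close>.\<close>

lemma exp_beats_pairs_of_subsets:
  fixes c :: real
  assumes "c * real m \<ge> 2" "0 < n"
  shows "exp (- c * real n) ^ m * real (card (Pow {1..n} \<times> Pow {1..n})) < 1"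
proof -
  have "real (card (Pow {1..n} \<times> Pow {1..n})) = 4 ^ n"
    by (simp add: card_cartesian_product card_Pow power_mult_distrib[symmetric])
  also have "\<dots> < exp 2 ^ n" using four_less_exp_2 assms(2) by (intro power_strict_mono) auto
  also have "\<dots> = exp (2 * real n)" by (simp add: exp_of_nat_mult[symmetric] mult.commute)
  also have "\<dots> \<le> exp (c * real m * real n)" using assms by (simp add: mult_right_mono)
  finally have "exp (- (c * real m * real n)) * real (card (Pow {1..n} \<times> Pow {1..n})) < 1"
    by (simp add: exp_minus field_simps)
  then show ?thesis by (simp add: exp_of_nat_mult[symmetric] mult_ac)
qed


text \<open>Delete from \<open>A\<close> every intersection with a member of \<open>G\<close> that
  has fewer than \<open>t\<close> points, at a cost of at most \<open>m * t\<close> points. Any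
  \<open>S\<close> in \<open>G\<close> that still meets the rest has a large intersection with
  \<open>A\<close>, so covering the trimmed sets in the weak sense covers the original ones in the
  strong sense.\<close>

lemma trim_small_intersections:
  fixes t :: real
  assumes "finite A" "finite G" "card G \<le> m" "0 \<le> t"
  obtains A' where "A' \<subseteq> A" "real (card A) - real m * t \<le> real (card A')"
    "\<And>S. S \<in> G \<Longrightarrow> A' \<inter> S \<noteq> {} \<Longrightarrow> t \<le> real (card (A \<inter> S))"
proof -
  define D where "D = (\<Union>S \<in> {S \<in> G. real (card (A \<inter> S)) < t}. A \<inter> S)"
  have finD: "finite D" "D \<subseteq> A" using assms by (auto simp: D_def)
  have "real (card D) \<le> (\<Sum>S \<in> {S \<in> G. real (card (A \<inter> S)) < t}. real (card (A \<inter> S)))"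
    unfolding D_def of_nat_sum[symmetric] of_nat_le_iff using assms by (intro card_UN_le) auto
  also have "\<dots> \<le> (\<Sum>S \<in> {S \<in> G. real (card (A \<inter> S)) < t}. t)" by (intro sum_mono) auto
  also have "\<dots> = real (card {S \<in> G. real (card (A \<inter> S)) < t}) * t" by simp
  also have "\<dots> \<le> real m * t"
    using assms card_mono[of G "{S \<in> G. real (card (A \<inter> S)) < t}"] by (intro mult_right_mono) auto
  finally have "real (card A) - real m * t \<le> real (card (A - D))"
    using finD assms(1) card_mono[OF assms(1) finD(2)] by (simp add: card_Diff_subset of_nat_diff)
  moreover have "t \<le> real (card (A \<inter> S))" if "S \<in> G" "(A - D) \<inter> S \<noteq> {}" for S
    using that by (fastforce simp: D_def)
  ultimately show ?thesis using that[of "A - D"] by blast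
qed

text \<open>Read \<open>\<pi>\<close> as a perfect matching between two copies of
  \<open>{1..n}\<close>; the counted set is the set of its edges from \<open>X\<close> to
  \<open>Y\<close>.\<close>

definition expanding :: "nat \<Rightarrow> real \<Rightarrow> real \<Rightarrow> (nat \<Rightarrow> nat) set \<Rightarrow> bool" where
  "expanding n \<kappa> \<theta> F \<longleftrightarrow>
    (\<forall>X \<subseteq> {1..n}. \<forall>Y \<subseteq> {1..n}. \<kappa> * real n \<le> real (card X) \<longrightarrow> \<kappa> * real n \<le> real (card Y) \<longrightarrow>
        (\<exists>\<pi>\<in>F. \<theta> * real n \<le> real (card {x \<in> X. \<pi> x \<in> Y})))"

text \<open>Two sets are split by the same \<open>S\<close> because one \<open>S\<close> has to
  serve the positive and the negative entries in \<open>J_event\<close>.\<close>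

definition splitting :: "nat \<Rightarrow> real \<Rightarrow> real \<Rightarrow> nat set set \<Rightarrow> bool" where
  "splitting N \<kappa> \<theta> F \<longleftrightarrow>
    (\<forall>A \<subseteq> {1..N}. \<forall>B \<subseteq> {1..N}. \<kappa> * real N \<le> real (card A) \<longrightarrow> \<kappa> * real N \<le> real (card B) \<longrightarrow>
        (\<exists>S\<in>F. \<theta> * real N \<le> real (card (A \<inter> S)) \<and> \<theta> * real N \<le> real (card (A - S)) \<and>
               \<theta> * real N \<le> real (card (B \<inter> S)) \<and> \<theta> * real N \<le> real (card (B - S))))"

lemma expanding_permutations:
  fixes \<kappa> :: real
  assumes "0 < \<kappa>"
  obtains m :: nat and \<theta> :: real where "0 < \<theta>"
    "\<And>n. 0 < n \<Longrightarrow> \<exists>F \<subseteq> perms n. finite F \<and> card F \<le> m \<and> expanding n \<kappa> \<theta> F"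
proof -
  \<comment> \<open>Half of the density is reserved for trimming: up to \<open>m\<close> deleted
    pieces of size below \<open>k / m * n\<close> cost at most \<open>k * n\<close> points, which
    fixes the final constant \<open>k / m\<close>.\<close>
  define k where "k = \<kappa> / 2"
  have k: "0 < k" "k \<le> \<kappa>" using assms by (auto simp: k_def)
  obtain m :: nat where m: "2 / k\<^sup>2 < real m" using reals_Archimedean2 by blast
  have km: "k\<^sup>2 * real m \<ge> 2" using m k by (simp add: field_simps)
  then have m0: "0 < m" using k by (cases m) auto
  have main: "\<exists>F \<subseteq> perms n. finite F \<and> card F \<le> m \<and> expanding n \<kappa> (k / real m) F" if n: "0 < n" for n
  proof -
    define T where "T = {(X, Y). X \<subseteq> {1..n} \<and> Y \<subseteq> {1..n} \<and>
      k * real n \<le> real (card X) \<and> k * real n \<le> real (card Y)}"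
    have TPow: "T \<subseteq> Pow {1..n} \<times> Pow {1..n}" by (auto simp: T_def)
    have finT: "finite T" by (rule finite_subset[OF TPow]) simp
    have perms: "finite (perms n)" "perms n \<noteq> {}"
      using permutes_id[of "{1..n}"] unfolding perms_def by (blast intro: finite_permutations)+
    have bad: "real (card {\<pi> \<in> perms n. case t of (X, Y) \<Rightarrow> \<pi> ` X \<inter> Y = {}})
        \<le> exp (- (k\<^sup>2) * real n) * real (card (perms n))" if "t \<in> T" for t
    proof -
      obtain X Y where t: "t = (X, Y)" by (cases t)
      have XY: "X \<subseteq> {1..n}" "Y \<subseteq> {1..n}" "k * real n \<le> real (card X)" "k * real n \<le> real (card Y)"
        using that by (auto simp: T_def t)
      have "real (card {\<pi> \<in> perms n. \<pi> ` X \<inter> Y = {}})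
          \<le> exp (- k * real (card X)) * real (card (perms n))"
        using card_permutes_image_disjoint_le[of "{1..n}" X Y k] XY k by (simp add: perms_def)
      \<comment> \<open>One factor \<open>k\<close> is the density of \<open>Y\<close>, the other
        comes from \<open>card X \<ge> k * n\<close>.\<close>
      also have "\<dots> \<le> exp (- (k\<^sup>2) * real n) * real (card (perms n))"
        using mult_left_mono[OF XY(3), of k] k
        by (intro mult_right_mono) (auto simp: power2_eq_square mult_ac)
      finally show ?thesis by (simp add: t)
    qed
    have "exp (- (k\<^sup>2) * real n) ^ m * real (card T)
        \<le> exp (- (k\<^sup>2) * real n) ^ m * real (card (Pow {1..n} \<times> Pow {1..n}))"
      using card_mono[OF _ TPow] by (intro mult_left_mono of_nat_mono) simp_all
    also have "\<dots> < 1" using exp_beats_pairs_of_subsets[OF km n] .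
    finally have small: "exp (- (k\<^sup>2) * real n) ^ m * real (card T) < 1" .
    obtain F where F: "F \<subseteq> perms n" "finite F" "card F \<le> m"
      "\<forall>t\<in>T. \<exists>\<pi>\<in>F. \<not> (case t of (X, Y) \<Rightarrow> \<pi> ` X \<inter> Y = {})"
      by (rule probabilistic_cover[OF perms finT exp_ge_zero bad small])
    have "\<exists>\<pi>\<in>F. k / real m * real n \<le> real (card {x \<in> X. \<pi> x \<in> Y})"
      if XY: "X \<subseteq> {1..n}" "Y \<subseteq> {1..n}" "\<kappa> * real n \<le> real (card X)" "\<kappa> * real n \<le> real (card Y)" for X Y
    proof -
      \<comment> \<open>Trimming \<open>X\<close> against the preimages of \<open>Y\<close> is
        enough; \<open>Y\<close> itself stays unchanged. As \<open>F\<close> already covers all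
        pairs of density \<open>k\<close>, it covers the trimmed pair although the trimming depends
        on \<open>F\<close>.\<close>
      have G: "finite ((\<lambda>\<pi>. {x. \<pi> x \<in> Y}) ` F)" "card ((\<lambda>\<pi>. {x. \<pi> x \<in> Y}) ` F) \<le> m"
        using F(2) order_trans[OF card_image_le[OF F(2)] F(3)] by simp_all
      obtain X' where X': "X' \<subseteq> X" "real (card X) - real m * (k / real m * real n) \<le> real (card X')"
        "\<And>S. S \<in> (\<lambda>\<pi>. {x. \<pi> x \<in> Y}) ` F \<Longrightarrow> X' \<inter> S \<noteq> {} \<Longrightarrow> k / real m * real n \<le> real (card (X \<inter> S))"
        by (rule trim_small_intersections[OF finite_subset[OF XY(1)] G, of "k / real m * real n"])
          (use k in auto)
      have "k * real n \<le> real (card X')" using X'(2) XY(3) m0 by (simp add: k_def)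
      moreover have "k * real n \<le> real (card Y)"
        using XY(4) mult_right_mono[OF k(2), of "real n"] by simp
      ultimately have "(X', Y) \<in> T" using XY X'(1) by (auto simp: T_def)
      then obtain \<pi> where \<pi>: "\<pi> \<in> F" "\<pi> ` X' \<inter> Y \<noteq> {}" using F(4) by fastforce
      have "k / real m * real n \<le> real (card (X \<inter> {x. \<pi> x \<in> Y}))"
        using \<pi> by (intro X'(3)) auto
      then show ?thesis using \<pi>(1) by (auto simp: Int_def)
    qed
    then have "expanding n \<kappa> (k / real m) F" by (simp add: expanding_def)
    then show ?thesis using F(1-3) by blast
  qed
  show ?thesis by (rule that[OF _ main]) (use k m0 in auto)
qed

text \<open>Same scheme as for permutations, with four ways to fail: \<open>S\<close> may miss or
  contain \<open>A\<close>, and miss or contain \<open>B\<close>. Absorbing the resulting factor 4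
  is what calls for the bound \<open>24 / k\<close> on \<open>N\<close>.\<close>

lemma splitting_half_subsets:
  fixes \<kappa> :: real
  assumes "0 < \<kappa>"
  obtains m N0 :: nat and \<theta> :: real where "0 < \<theta>"
    "\<And>N. N0 \<le> N \<Longrightarrow> \<exists>F \<subseteq> half_subsets N. finite F \<and> card F \<le> m \<and> splitting N \<kappa> \<theta> F"
proof -
  define k where "k = \<kappa> / 2"
  have k: "0 < k" using assms by (auto simp: k_def)
  obtain m :: nat where m: "8 / k < real m" using reals_Archimedean2 by blast
  have km: "k / 4 * real m \<ge> 2" using m k by (simp add: field_simps)
  then have m0: "0 < m" using k by (cases m) auto
  obtain N1 :: nat where N1: "24 / k < real N1" using reals_Archimedean2 by blast
  \<comment> \<open>The factor 2 is there because sets are trimmed against each \<open>S\<close> and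
    its complement.\<close>
  define \<theta> where "\<theta> = k / (2 * real m)"
  have main: "\<exists>F \<subseteq> half_subsets N. finite F \<and> card F \<le> m \<and> splitting N \<kappa> \<theta> F"
    if N: "max 2 N1 \<le> N" for N
  proof -
    define h where "h = N div 2"
    have "24 / k < real N" using N1 N by linarith
    then have kN: "24 \<le> k * real N" using k by (simp add: field_simps)
    \<comment> \<open>Rounding down costs most at \<open>N = 3\<close>, where
      \<open>h = 1\<close>.\<close>
    have "N \<le> 3 * h" "N \<le> 3 * (N - h)" and hN3: "h \<le> N"
      using N unfolding h_def by auto
    then have hN: "real N / 3 \<le> real h" "real N / 3 \<le> real (N - h)" "h \<le> N"
      by (simp_all add: field_simps flip: of_nat_diff)
    define P :: "nat set \<times> nat set \<Rightarrow> nat set \<Rightarrow> bool" where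
      "P = (\<lambda>(A, B) S. S \<inter> A = {} \<or> A \<subseteq> S \<or> S \<inter> B = {} \<or> B \<subseteq> S)"
    define T where "T = {(A, B). A \<subseteq> {1..N} \<and> B \<subseteq> {1..N} \<and>
      k * real N \<le> real (card A) \<and> k * real N \<le> real (card B)}"
    have TPow: "T \<subseteq> Pow {1..N} \<times> Pow {1..N}" by (auto simp: T_def)
    have finT: "finite T" by (rule finite_subset[OF TPow]) simp
    have cardH: "card (half_subsets N) = N choose h"
      using n_subsets[of "{1..N}" h] by (simp add: half_subsets_def h_def)
    have half: "finite (half_subsets N)" "half_subsets N \<noteq> {}"
    proof -
      show "finite (half_subsets N)"
        by (rule finite_subset[of _ "Pow {1..N}"]) (auto simp: half_subsets_def)
      show "half_subsets N \<noteq> {}" using cardH hN(3) by (metis binomial_eq_0_iff card.empty not_le)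
    qed
    have one: "real (card {S \<in> half_subsets N. S \<inter> A = {}}) \<le> exp (- k * (real N / 3)) * real (N choose h)"
      "real (card {S \<in> half_subsets N. A \<subseteq> S}) \<le> exp (- k * (real N / 3)) * real (N choose h)"
      if A: "A \<subseteq> {1..N}" "k * real N \<le> real (card A)" for A
    proof -
      have "real (card {S \<in> half_subsets N. S \<inter> A = {}}) \<le> exp (- k * real h) * real (N choose h)"
        using card_subsets_disjoint_le[of "{1..N}" A k h] A k by (simp add: half_subsets_def h_def)
      also have "\<dots> \<le> exp (- k * (real N / 3)) * real (N choose h)"
        using mult_left_mono[OF hN(1), of k] k by (intro mult_right_mono) auto
      finally show "real (card {S \<in> half_subsets N. S \<inter> A = {}})
        \<le> exp (- k * (real N / 3)) * real (N choose h)" .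
      have "real (card {S \<in> half_subsets N. A \<subseteq> S}) \<le> exp (- k * real (N - h)) * real (N choose h)"
        using card_subsets_superset_le[of "{1..N}" A k h] A k hN(3) by (simp add: half_subsets_def h_def)
      also have "\<dots> \<le> exp (- k * (real N / 3)) * real (N choose h)"
        using mult_left_mono[OF hN(2), of k] k by (intro mult_right_mono) auto
      finally show "real (card {S \<in> half_subsets N. A \<subseteq> S})
        \<le> exp (- k * (real N / 3)) * real (N choose h)" .
    qed
    have bad: "real (card {S \<in> half_subsets N. P t S})
        \<le> exp (- (k / 4) * real N) * real (card (half_subsets N))" if "t \<in> T" for t
    proof -
      obtain A B where t: "t = (A, B)" by (cases t)
      have AB: "A \<subseteq> {1..N}" "B \<subseteq> {1..N}" "k * real N \<le> real (card A)" "k * real N \<le> real (card B)"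
        using that by (auto simp: T_def t)
      have "{S \<in> half_subsets N. P t S} =
          ({S \<in> half_subsets N. S \<inter> A = {}} \<union> {S \<in> half_subsets N. A \<subseteq> S}) \<union>
          ({S \<in> half_subsets N. S \<inter> B = {}} \<union> {S \<in> half_subsets N. B \<subseteq> S})"
        by (auto simp: P_def t)
      then have "card {S \<in> half_subsets N. P t S} \<le>
          (card {S \<in> half_subsets N. S \<inter> A = {}} + card {S \<in> half_subsets N. A \<subseteq> S}) +
          (card {S \<in> half_subsets N. S \<inter> B = {}} + card {S \<in> half_subsets N. B \<subseteq> S})"
        using order_trans[OF card_Un_le add_mono[OF card_Un_le card_Un_le]] by simp
      then have "real (card {S \<in> half_subsets N. P t S}) \<le> 4 * (exp (- k * (real N / 3)) * real (N choose h))"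
        using one[OF AB(1,3)] one[OF AB(2,4)] by linarith
      \<comment> \<open>The factor 4 is paid for out of the exponent:
        \<open>1/3 - 1/12 = 1/4\<close>, and \<open>k * N \<ge> 24\<close> gives
        \<open>exp (k * N / 12) \<ge> exp 2 > 4\<close>.\<close>
      also have "\<dots> \<le> exp (k * real N / 12) * (exp (- k * (real N / 3)) * real (N choose h))"
      proof (intro mult_right_mono)
        have "exp 2 \<le> exp (k * real N / 12)" using kN by simp
        then show "4 \<le> exp (k * real N / 12)" using four_less_exp_2 by linarith
      qed auto
      also have "\<dots> = exp (- (k / 4) * real N) * real (card (half_subsets N))"
        by (simp add: cardH mult.assoc[symmetric] exp_add[symmetric] del: exp_minus)
      finally show ?thesis .
    qed
    have "exp (- (k / 4) * real N) ^ m * real (card T)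
        \<le> exp (- (k / 4) * real N) ^ m * real (card (Pow {1..N} \<times> Pow {1..N}))"
      using card_mono[OF _ TPow] by (intro mult_left_mono of_nat_mono) simp_all
    also have "\<dots> < 1" using exp_beats_pairs_of_subsets[OF km] N by simp
    finally have small: "exp (- (k / 4) * real N) ^ m * real (card T) < 1" .
    obtain F where F: "F \<subseteq> half_subsets N" "finite F" "card F \<le> m"
      "\<forall>t\<in>T. \<exists>S\<in>F. \<not> P t S"
      by (rule probabilistic_cover[OF half finT exp_ge_zero bad small])
    \<comment> \<open>Meeting \<open>- S\<close> is the same as not being contained in
      \<open>S\<close>, so one trimming handles both requirements.\<close>
    define G where "G = F \<union> uminus ` F"
    have "card G \<le> card F + card (uminus ` F)" unfolding G_def by (rule card_Un_le)
    then have G: "finite G" "card G \<le> 2 * m"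
      using F(2,3) card_image_le[OF F(2), of uminus] by (auto simp: G_def)
    have trim: "\<exists>A' \<subseteq> A. k * real N \<le> real (card A') \<and>
        (\<forall>S\<in>F. (A' \<inter> S \<noteq> {} \<longrightarrow> \<theta> * real N \<le> real (card (A \<inter> S))) \<and>
               (\<not> A' \<subseteq> S \<longrightarrow> \<theta> * real N \<le> real (card (A - S))))"
      if A: "A \<subseteq> {1..N}" "\<kappa> * real N \<le> real (card A)" for A
    proof -
      have "0 \<le> \<theta> * real N" using k by (simp add: \<theta>_def)
      then obtain A' where A': "A' \<subseteq> A" "real (card A) - real (2 * m) * (\<theta> * real N) \<le> real (card A')"
        "\<And>S. S \<in> G \<Longrightarrow> A' \<inter> S \<noteq> {} \<Longrightarrow> \<theta> * real N \<le> real (card (A \<inter> S))"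
        using trim_small_intersections[OF finite_subset[OF A(1)] G] by auto
      have "k * real N \<le> real (card A')" using A'(2) A(2) m0 by (simp add: k_def \<theta>_def)
      moreover have "\<theta> * real N \<le> real (card (A - S))" if "S \<in> F" "\<not> A' \<subseteq> S" for S
        using A'(3)[of "- S"] that by (auto simp: G_def Diff_eq)
      moreover have "\<theta> * real N \<le> real (card (A \<inter> S))" if "S \<in> F" "A' \<inter> S \<noteq> {}" for S
        using A'(3)[of S] that by (simp add: G_def)
      ultimately show ?thesis using A'(1) by (intro exI[of _ A']) blast
    qed
    have "\<exists>S\<in>F. \<theta> * real N \<le> real (card (A \<inter> S)) \<and> \<theta> * real N \<le> real (card (A - S)) \<and>
               \<theta> * real N \<le> real (card (B \<inter> S)) \<and> \<theta> * real N \<le> real (card (B - S))"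
      if AB: "A \<subseteq> {1..N}" "B \<subseteq> {1..N}" "\<kappa> * real N \<le> real (card A)" "\<kappa> * real N \<le> real (card B)" for A B
    proof -
      obtain A' where A': "A' \<subseteq> A" "k * real N \<le> real (card A')"
        "\<forall>S\<in>F. (A' \<inter> S \<noteq> {} \<longrightarrow> \<theta> * real N \<le> real (card (A \<inter> S))) \<and>
               (\<not> A' \<subseteq> S \<longrightarrow> \<theta> * real N \<le> real (card (A - S)))"
        using trim[OF AB(1,3)] by (elim exE conjE) (rule that)
      obtain B' where B': "B' \<subseteq> B" "k * real N \<le> real (card B')"
        "\<forall>S\<in>F. (B' \<inter> S \<noteq> {} \<longrightarrow> \<theta> * real N \<le> real (card (B \<inter> S))) \<and>
               (\<not> B' \<subseteq> S \<longrightarrow> \<theta> * real N \<le> real (card (B - S)))"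
        using trim[OF AB(2,4)] by (elim exE conjE) (rule that)
      have "(A', B') \<in> T" using A'(1,2) B'(1,2) AB unfolding T_def by blast
      then obtain S where "S \<in> F" "\<not> P (A', B') S" using F(4) by blast
      then show ?thesis
        using A'(3)[rule_format, of S] B'(3)[rule_format, of S] by (auto simp: P_def Int_commute)
    qed
    then have "splitting N \<kappa> \<theta> F" by (simp add: splitting_def)
    then show ?thesis using F(1-3) by blast
  qed
  have "0 < \<theta>" using k m0 by (simp add: \<theta>_def)
  then show ?thesis using main by (rule that)
qed

section \<open>From matchings of the two halves to permutations\<close>

text \<open>The ordering \<open>1, n + \<pi> 1, 2, n + \<pi> 2, ...\<close> puts the ends of each
  edge of the matching next to each other. For odd \<open>N\<close> the last point is fixed.\<close>

lemma interleaving_permutation: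
  assumes "\<pi> permutes {1..n}" "n = N div 2"
  obtains \<sigma> where "\<sigma> \<in> perms N" "\<And>j. j \<in> {1..n} \<Longrightarrow> \<sigma> (2 * j - 1) = j"
    "\<And>j. j \<in> {1..n} \<Longrightarrow> \<sigma> (2 * j) = n + \<pi> j"
proof -
  define \<sigma> where "\<sigma> i = (if i \<in> {1..2*n} then if even i then n + \<pi> (i div 2) else (i + 1) div 2 else i)" for i
  \<comment> \<open>On a finite set surjectivity suffices. The cases are the lower half, the upper
    half and the point left over when \<open>N\<close> is odd.\<close>
  have "{1..N} \<subseteq> \<sigma> ` {1..N}"
  proof
    fix y assume y: "y \<in> {1..N}"
    consider "y \<le> n" | "n < y" "y \<le> 2 * n" | "2 * n < y" by linarith
    then show "y \<in> \<sigma> ` {1..N}"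
    proof cases
      case 1
      then have "y = \<sigma> (2 * y - 1)" "2 * y - 1 \<in> {1..N}" using y assms(2) by (auto simp: \<sigma>_def)
      then show ?thesis by (rule image_eqI)
    next
      case 2
      then have "y - n \<in> \<pi> ` {1..n}" using permutes_image[OF assms(1)] by auto
      then obtain j where j: "j \<in> {1..n}" "y - n = \<pi> j" by blast
      then have "y = \<sigma> (2 * j)" "2 * j \<in> {1..N}" using 2 assms(2) by (auto simp: \<sigma>_def)
      then show ?thesis by (rule image_eqI)
    next
      case 3
      then have "y = \<sigma> y" by (simp add: \<sigma>_def)
      then show ?thesis using y by (rule image_eqI)
    qed
  qed
  then have "\<sigma> ` {1..N} = {1..N}"
    using card_image_le[of "{1..N}" \<sigma>] by (intro card_seteq[symmetric]) auto
  then have "bij_betw \<sigma> {1..N} {1..N}"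
    by (simp add: bij_betw_def eq_card_imp_inj_on)
  then have "\<sigma> permutes {1..N}"
    by (rule bij_imp_permutes) (use assms(2) in \<open>auto simp: \<sigma>_def\<close>)
  then show ?thesis by (intro that[of \<sigma>]) (auto simp: perms_def \<sigma>_def)
qed

section \<open>Moderate entries of incompressible vectors\<close>

lemma many_moderate_positive_entries:
  fixes x :: "'a \<Rightarrow> real" and c :: real
  assumes "finite I" "(\<Sum>i\<in>I. x i) = 0" "(\<Sum>i\<in>I. (x i)\<^sup>2) = real (card I)"
    "c * real (card I) \<le> (\<Sum>i\<in>I. \<bar>x i\<bar>)" "0 < c"
  shows "c\<^sup>2 / 32 * real (card I) \<le> real (card {i \<in> I. x i \<in> {c/8..8/c}})"
proof -
  \<comment> \<open>The left side is the positive part. Small entries are paid for by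
    \<open>c/8\<close>, entries above \<open>8/c\<close> by the quadratic term, and only the
    moderate ones by the last term. Summed up, the first two use at most half of the positive mass
    \<open>c/2 * card I\<close>.\<close>
  have pt: "(x i + \<bar>x i\<bar>) / 2 \<le> c/8 + c/8 * (x i)\<^sup>2 + (if x i \<in> {c/8..8/c} then 8/c else 0)" for i
  proof -
    have *: "0 \<le> c/8 * (x i)\<^sup>2" using assms(5) by simp
    have **: "0 \<le> (if x i \<in> {c/8..8/c} then 8/c else 0)" using assms(5) by simp
    consider "x i \<le> c/8" | "x i \<in> {c/8..8/c}" | "8/c < x i" "c/8 < x i" by fastforce
    then show ?thesis
    proof cases
      case 1
      then have "(x i + \<bar>x i\<bar>) / 2 \<le> c/8" using assms(5) by (cases "0 \<le> x i") auto
      then show ?thesis using * ** by linarith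
    next
      case 2
      then have "(x i + \<bar>x i\<bar>) / 2 \<le> 8/c" using assms(5) by (auto simp: abs_if)
      moreover have "(if x i \<in> {c/8..8/c} then 8/c else 0) = 8/c" using 2 by simp
      ultimately show ?thesis using * assms(5) by linarith
    next
      case 3
      then have "x i * 1 \<le> x i * (c/8 * x i)"
        using assms(5) by (intro mult_left_mono) (auto simp: field_simps)
      moreover have "0 < x i" using 3 assms(5) by (smt (verit) divide_pos_pos)
      moreover have "x i * (c/8 * x i) = c/8 * (x i)\<^sup>2" by (simp add: power2_eq_square)
      moreover have "(x i + \<bar>x i\<bar>) / 2 = x i" using \<open>0 < x i\<close> by simp
      ultimately show ?thesis using ** assms(5) by linarith
    qed
  qed
  have "c * real (card I) / 2 \<le> (\<Sum>i\<in>I. (x i + \<bar>x i\<bar>) / 2)"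
    using assms(2,4) by (simp add: sum_divide_distrib[symmetric] sum.distrib)
  also have "\<dots> \<le> (\<Sum>i\<in>I. c/8 + c/8 * (x i)\<^sup>2 + (if x i \<in> {c/8..8/c} then 8/c else 0))"
    by (intro sum_mono pt)
  also have "\<dots> = c/8 * real (card I) + c/8 * real (card I) + real (card {i\<in>I. x i \<in> {c/8..8/c}}) * (8/c)"
    unfolding sum.distrib sum_distrib_left[symmetric] assms(3)
    using assms(1) by (simp add: sum.If_cases Int_def)
  finally have "c * real (card I) / 4 \<le> real (card {i\<in>I. x i \<in> {c/8..8/c}}) * (8/c)" by simp
  from mult_left_mono[OF this, of "c/8"] show ?thesis
    using assms(5) by (simp add: power2_eq_square)
qed

text \<open>Keep only the entries with \<open>\<bar>v i\<bar> * sqrt N \<ge> \<rho>\<close>. The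
  discarded part has norm at most \<open>\<rho>\<close>, so incompressibility forces more than
  \<open>\<delta> * N\<close> entries to be kept, each contributing at least
  \<open>\<rho>\<close>.\<close>

lemma Incomp_sum_abs_ge:
  assumes v: "v \<in> Incomp N \<delta> \<rho>" and "0 < \<rho>"
  shows "\<delta> * \<rho> * real N \<le> (\<Sum>i\<in>{1..N}. \<bar>v i * sqrt (real N)\<bar>)"
proof -
  define L where "L = {i \<in> {1..N}. \<rho> \<le> \<bar>v i * sqrt (real N)\<bar>}"
  define u where "u = (\<lambda>i\<in>{1..N}. if i \<in> L then v i else 0)"
  \<comment> \<open>In dimension 0 the norm is an empty sum, so the sphere is empty.\<close>
  have "N \<noteq> 0"
    using v by (intro notI) (simp add: Incomp_def unit_sphere_def)
  have small: "(v i - u i)\<^sup>2 \<le> \<rho>\<^sup>2 / real N" if "i \<in> {1..N}" for i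
  proof (cases "i \<in> L")
    case False
    then have "\<bar>v i * sqrt (real N)\<bar> < \<rho>" using that by (auto simp: L_def)
    then have "(v i * sqrt (real N))\<^sup>2 \<le> \<rho>\<^sup>2"
      using assms(2) by (intro abs_le_square_iff[THEN iffD1]) auto
    then show ?thesis using False that \<open>N \<noteq> 0\<close> by (simp add: u_def power_mult_distrib field_simps)
  qed (use that in \<open>simp add: u_def\<close>)
  have "(\<Sum>i\<in>{1..N}. (v i - u i)\<^sup>2) \<le> (\<Sum>i\<in>{1..N}. \<rho>\<^sup>2 / real N)"
    by (intro sum_mono small)
  then have "L2_set (\<lambda>i. v i - u i) {1..N} \<le> \<rho>"
    using \<open>N \<noteq> 0\<close> assms(2) by (simp add: L2_set_def real_le_lsqrt)
  moreover have "u \<in> vecs N" by (simp add: u_def vecs_def)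
  ultimately have "\<not> real (card {i \<in> {1..N}. u i \<noteq> 0}) \<le> \<delta> * real N"
    using v by (auto simp: Incomp_def Comp_def)
  moreover have "card {i \<in> {1..N}. u i \<noteq> 0} \<le> card L"
    by (intro card_mono) (auto simp: u_def L_def)
  ultimately have "\<delta> * real N \<le> real (card L)" by linarith
  then have "\<delta> * \<rho> * real N \<le> (\<Sum>i\<in>L. \<rho>)"
    using mult_right_mono[of "\<delta> * real N" "real (card L)" \<rho>] assms(2) by (simp add: mult_ac)
  also have "\<dots> \<le> (\<Sum>i\<in>L. \<bar>v i * sqrt (real N)\<bar>)" by (intro sum_mono) (auto simp: L_def)
  also have "\<dots> \<le> (\<Sum>i\<in>{1..N}. \<bar>v i * sqrt (real N)\<bar>)" by (intro sum_mono2) (auto simp: L_def)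
  finally show ?thesis .
qed

text \<open>The rescaled entries \<open>v i * sqrt N\<close> have mean 0 and mean square 1. These
  properties survive a change of sign, which yields the negative window.\<close>

lemma Incomp0_moderate_entries:
  assumes v: "v \<in> Incomp0 N \<delta> \<rho>" and pos: "0 < \<delta>" "0 < \<rho>"
  defines "c \<equiv> \<delta> * \<rho>"
  shows "c\<^sup>2 / 32 * real N \<le> real (card {i \<in> {1..N}. v i * sqrt (real N) \<in> {c/8..8/c}})"
    and "c\<^sup>2 / 32 * real N \<le> real (card {i \<in> {1..N}. v i * sqrt (real N) \<in> {-(8/c)..-(c/8)}})"
proof -
  have c: "0 < c" using pos by (simp add: c_def)
  have "v \<in> Incomp N \<delta> \<rho>" and sum: "(\<Sum>i\<in>{1..N}. v i) = 0" using v by (auto simp: Incomp0_def)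
  then have abs: "c * real N \<le> (\<Sum>i\<in>{1..N}. \<bar>v i * sqrt (real N)\<bar>)"
    and "L2_set v {1..N} = 1"
    using Incomp_sum_abs_ge pos(2) by (auto simp: c_def Incomp_def unit_sphere_def)
  then have sq: "(\<Sum>i\<in>{1..N}. (v i * sqrt (real N))\<^sup>2) = real N"
    by (simp add: L2_set_def power_mult_distrib sum_distrib_right[symmetric])
  have sum': "(\<Sum>i\<in>{1..N}. v i * sqrt (real N)) = 0"
    using sum by (simp add: sum_distrib_right[symmetric])
  show "c\<^sup>2 / 32 * real N \<le> real (card {i \<in> {1..N}. v i * sqrt (real N) \<in> {c/8..8/c}})"
    using many_moderate_positive_entries[of "{1..N}" "\<lambda>i. v i * sqrt (real N)" c] c abs sq sum' by simp
  have "{i \<in> {1..N}. v i * sqrt (real N) \<in> {-(8/c)..-(c/8)}}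
      = {i \<in> {1..N}. - (v i * sqrt (real N)) \<in> {c/8..8/c}}" by auto
  then show "c\<^sup>2 / 32 * real N \<le> real (card {i \<in> {1..N}. v i * sqrt (real N) \<in> {-(8/c)..-(c/8)}})"
    using many_moderate_positive_entries[of "{1..N}" "\<lambda>i. - (v i * sqrt (real N))" c] c abs sq sum'
    by (simp add: sum_negf)
qed

section \<open>Gaps between the two halves of the index set\<close>

text \<open>The \<open>+ 1\<close> accounts for the index \<open>N\<close>, which lies in neither
  half when \<open>N\<close> is odd.\<close>

lemma card_le_halves:
  fixes Z :: "nat set"
  assumes "Z \<subseteq> {1..N}" "n = N div 2"
  shows "card Z \<le> card {j \<in> {1..n}. j \<in> Z} + card {j \<in> {1..n}. n + j \<in> Z} + 1"
proof -
  have "Z \<subseteq> {j \<in> {1..n}. j \<in> Z} \<union> (+) n ` {j \<in> {1..n}. n + j \<in> Z} \<union> {N}"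
  proof
    fix z assume z: "z \<in> Z"
    then have "z \<in> {1..N}" using assms(1) by blast
    then have "z \<le> n \<and> 1 \<le> z \<or> z - n \<in> {1..n} \<and> z = n + (z - n) \<or> z = N" using assms(2) by auto
    then show "z \<in> {j \<in> {1..n}. j \<in> Z} \<union> (+) n ` {j \<in> {1..n}. n + j \<in> Z} \<union> {N}"
      using z by (metis (no_types, lifting) UnCI atLeastAtMost_iff image_eqI mem_Collect_eq singletonI)
  qed
  then have "card Z \<le> card ({j \<in> {1..n}. j \<in> Z} \<union> (+) n ` {j \<in> {1..n}. n + j \<in> Z} \<union> {N})"
    by (intro card_mono) auto
  also have "\<dots> \<le> card {j \<in> {1..n}. j \<in> Z} + card ((+) n ` {j \<in> {1..n}. n + j \<in> Z}) + card {N}"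
    by (meson card_Un_le add_mono le_trans order_refl)
  also have "card ((+) n ` {j \<in> {1..n}. n + j \<in> Z}) \<le> card {j \<in> {1..n}. n + j \<in> Z}"
    by (intro card_image_le) auto
  finally show ?thesis by simp
qed

text \<open>Interleaved neighbours always lie in opposite halves, so the gap is needed between a set
  of lower indices and a set of upper ones, wherever the large entries happen to sit.\<close>

lemma separated_halves:
  fixes x :: "nat \<Rightarrow> real" and \<mu> \<nu> :: real
  assumes n: "n = N div 2" and \<mu>: "0 < \<mu>" "\<mu> \<le> 1/2" "2 / \<mu> \<le> real N" and "0 \<le> \<nu>"
    and A: "\<mu> * real N \<le> real (card {i \<in> {1..N}. \<nu> \<le> x i})"
    and B: "\<mu> * real N \<le> real (card {i \<in> {1..N}. x i \<le> - \<nu>})"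
  obtains X Y where "X \<subseteq> {1..n}" "Y \<subseteq> {1..n}"
    "\<mu> / 4 * real N \<le> real (card X)" "\<mu> / 4 * real N \<le> real (card Y)"
    "\<And>i j. i \<in> X \<Longrightarrow> j \<in> Y \<Longrightarrow> \<nu> \<le> \<bar>x i - x (n + j)\<bar>"
proof -
  note that_halves = that
  define lo where "lo P = {j \<in> {1..n}. P (x j)}" for P :: "real \<Rightarrow> bool"
  define hi where "hi P = {j \<in> {1..n}. P (x (n + j))}" for P :: "real \<Rightarrow> bool"
  define t where "t = \<mu> / 4 * real N"
  \<comment> \<open>The leftover index thus costs at most half of \<open>\<mu> * N\<close>; one of
    the two halves keeps at least a quarter, which is \<open>t\<close>.\<close>
  have muN: "2 \<le> \<mu> * real N" using \<mu> by (simp add: field_simps)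
  have N4: "4 \<le> real N" using \<mu> muN mult_right_mono[of \<mu> "1/2" "real N"] by simp
  have split: "t \<le> real (card (lo P)) \<or> t \<le> real (card (hi P))"
    if "\<mu> * real N \<le> real (card {i \<in> {1..N}. P (x i)})" for P
  proof -
    have "card {i \<in> {1..N}. P (x i)} \<le> card {j \<in> {1..n}. j \<in> {i \<in> {1..N}. P (x i)}}
        + card {j \<in> {1..n}. n + j \<in> {i \<in> {1..N}. P (x i)}} + 1"
      by (rule card_le_halves[OF _ n]) auto
    also have "{j \<in> {1..n}. j \<in> {i \<in> {1..N}. P (x i)}} = lo P" using n by (auto simp: lo_def)
    also have "{j \<in> {1..n}. n + j \<in> {i \<in> {1..N}. P (x i)}} = hi P" using n by (auto simp: hi_def)
    finally have "\<mu> * real N \<le> real (card (lo P)) + real (card (hi P)) + 1" using that by linarith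
    then show ?thesis using muN by (auto simp: t_def)
  qed
  \<comment> \<open>Pigeonhole on the weak signs: one occurs at least \<open>n / 2\<close> times,
    and \<open>n / 2 \<ge> N / 8 \<ge> t\<close>.\<close>
  have sign: "t \<le> real (card {j \<in> {1..n}. 0 \<le> f j}) \<or> t \<le> real (card {j \<in> {1..n}. f j \<le> 0})"
    for f :: "nat \<Rightarrow> real"
  proof -
    have "card {1..n} \<le> card ({j \<in> {1..n}. 0 \<le> f j} \<union> {j \<in> {1..n}. f j \<le> 0})"
      by (intro card_mono) auto
    also have "\<dots> \<le> card {j \<in> {1..n}. 0 \<le> f j} + card {j \<in> {1..n}. f j \<le> 0}" by (rule card_Un_le)
    finally have "real n \<le> real (card {j \<in> {1..n}. 0 \<le> f j}) + real (card {j \<in> {1..n}. f j \<le> 0})"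
      by simp
    moreover have "real N \<le> 2 * real n + 1" using n by linarith
    moreover have "t \<le> real N / 8"
      using \<mu> mult_right_mono[of \<mu> "1/2" "real N"] by (simp add: t_def)
    ultimately show ?thesis using N4 by linarith
  qed
  have sub: "lo P \<subseteq> {1..n}" "hi P \<subseteq> {1..n}" for P by (auto simp: lo_def hi_def)
  have pair: thesis if "t \<le> real (card (lo P))" "t \<le> real (card (hi Q))"
    "\<And>a b. P a \<Longrightarrow> Q b \<Longrightarrow> \<nu> \<le> \<bar>a - b\<bar>" for P Q
    by (rule that_halves[OF sub, of P Q]) (use that in \<open>auto simp: lo_def hi_def t_def\<close>)
  txt \<open>If the large positive and large negative entries both concentrate on the same half, the sign
    occurring more often on the other half still gives a gap of \<open>\<nu>\<close>.\<close>
  have lo0: "t \<le> real (card (lo ((\<le>) 0))) \<or> t \<le> real (card (lo (\<lambda>a. a \<le> 0)))"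
    using sign[of x] by (simp add: lo_def)
  have hi0: "t \<le> real (card (hi ((\<le>) 0))) \<or> t \<le> real (card (hi (\<lambda>a. a \<le> 0)))"
    using sign[of "\<lambda>j. x (n + j)"] by (simp add: hi_def)
  consider "t \<le> real (card (lo ((\<le>) \<nu>)))" "t \<le> real (card (hi (\<lambda>a. a \<le> - \<nu>)))"
    | "t \<le> real (card (lo (\<lambda>a. a \<le> - \<nu>)))" "t \<le> real (card (hi ((\<le>) \<nu>)))"
    | "t \<le> real (card (lo ((\<le>) \<nu>)))" "t \<le> real (card (hi (\<lambda>a. a \<le> 0)))"
    | "t \<le> real (card (lo (\<lambda>a. a \<le> - \<nu>)))" "t \<le> real (card (hi ((\<le>) 0)))"
    | "t \<le> real (card (lo (\<lambda>a. a \<le> 0)))" "t \<le> real (card (hi ((\<le>) \<nu>)))"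
    | "t \<le> real (card (lo ((\<le>) 0)))" "t \<le> real (card (hi (\<lambda>a. a \<le> - \<nu>)))"
    using split[OF A] split[OF B] lo0 hi0 by blast
  then show thesis
    by cases (erule (1) pair, use \<open>0 \<le> \<nu>\<close> in linarith)+
qed

text \<open>Each matching edge from \<open>X\<close> to \<open>Y\<close> yields a gap at the
  position \<open>2 * j - 1\<close>, and distinct edges give distinct positions.\<close>

lemma I_event_interleaving:
  assumes n: "n = N div 2"
    and \<sigma>: "\<And>j. j \<in> {1..n} \<Longrightarrow> \<sigma> (2 * j - 1) = j" "\<And>j. j \<in> {1..n} \<Longrightarrow> \<sigma> (2 * j) = n + \<pi> j"
    and X: "X \<subseteq> {1..n}"
    and sep: "\<And>i j. i \<in> X \<Longrightarrow> j \<in> Y \<Longrightarrow> \<nu>2 \<le> \<bar>w i - w (n + j)\<bar> * sqrt (real N)"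
    and many: "\<nu>1 * real N \<le> real (card {j \<in> X. \<pi> j \<in> Y})"
  shows "I_event N \<nu>1 \<nu>2 w \<sigma>"
proof -
  have "card {j \<in> X. \<pi> j \<in> Y} \<le> card {i \<in> {1..N-1}. \<bar>w (\<sigma> i) - w (\<sigma> (i+1))\<bar> * sqrt (real N) \<ge> \<nu>2}"
  proof (rule card_inj_on_le[where f = "\<lambda>j. 2 * j - 1"])
    show "inj_on (\<lambda>j. 2 * j - 1) {j \<in> X. \<pi> j \<in> Y}"
    proof (rule inj_onI)
      fix i j assume "i \<in> {j \<in> X. \<pi> j \<in> Y}" "j \<in> {j \<in> X. \<pi> j \<in> Y}" "2 * i - 1 = 2 * j - 1"
      moreover from this X have "1 \<le> i" "1 \<le> j" by auto
      ultimately show "i = j" by linarith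
    qed
    show "(\<lambda>j. 2 * j - 1) ` {j \<in> X. \<pi> j \<in> Y}
        \<subseteq> {i \<in> {1..N-1}. \<bar>w (\<sigma> i) - w (\<sigma> (i+1))\<bar> * sqrt (real N) \<ge> \<nu>2}"
    proof (rule image_subsetI)
      fix j assume j: "j \<in> {j \<in> X. \<pi> j \<in> Y}"
      then have j': "j \<in> {1..n}" using X by blast
      then have "2 * j - 1 + 1 = 2 * j" "2 * j - 1 \<in> {1..N-1}" using n by auto
      then show "2 * j - 1 \<in> {i \<in> {1..N-1}. \<bar>w (\<sigma> i) - w (\<sigma> (i+1))\<bar> * sqrt (real N) \<ge> \<nu>2}"
        using \<sigma>[OF j'] sep[of j "\<pi> j"] j by simp
    qed
  qed simp
  then show ?thesis using many unfolding I_event_def by linarith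
qed

section \<open>Assembling the family\<close>

theorem lemma2p6:
  fixes \<delta> \<rho> :: real
  assumes "0 < \<delta>" "\<delta> < 1" "0 < \<rho>" "\<rho> < 1"
  shows "\<exists>(\<nu>1::real) (\<nu>2::real) (\<nu>3::real) (m::nat) (N0::nat).
    \<nu>1 > 0 \<and> \<nu>2 > 0 \<and> \<nu>3 > 0 \<and>
    (\<forall>N\<ge>N0. \<exists>R. R \<subseteq> perms N \<times> half_subsets N \<and> card R = m \<and>
       (\<forall>w \<in> Incomp0 N \<delta> \<rho>. \<forall>v \<in> Incomp0 N \<delta> \<rho>. \<exists>(\<sigma>, S) \<in> R.
          I_event N \<nu>1 \<nu>2 w \<sigma> \<and> J_event N \<nu>1 \<nu>2 \<nu>3 v S))"
proof -
  define c where "c = \<delta> * \<rho>"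
  have c: "0 < c" "c < 1" using assms mult_strict_mono[of \<delta> 1 \<rho> 1] by (auto simp: c_def)
  define \<mu> where "\<mu> = c\<^sup>2 / 32"
  have \<mu>: "0 < \<mu>" "\<mu> \<le> 1/2" using c power_le_one[of c 2] by (auto simp: \<mu>_def)
  obtain m1 \<theta>1 where \<theta>1: "0 < \<theta>1" and
    perm_family: "\<And>n. 0 < n \<Longrightarrow> \<exists>F \<subseteq> perms n. finite F \<and> card F \<le> m1 \<and> expanding n (\<mu> / 4) \<theta>1 F"
    by (rule expanding_permutations[of "\<mu> / 4"]) (use \<mu>(1) in auto)
  obtain m2 N2 \<theta>2 where \<theta>2: "0 < \<theta>2" and
    set_family: "\<And>N. N2 \<le> N \<Longrightarrow> \<exists>F \<subseteq> half_subsets N. finite F \<and> card F \<le> m2 \<and> splitting N \<mu> \<theta>2 F"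
    by (rule splitting_half_subsets[OF \<mu>(1)]) auto
  \<comment> \<open>The matchings live on \<open>n = N div 2\<close> points, and
    \<open>n \<ge> N / 3\<close>; hence the factor 1/3.\<close>
  define \<nu>1 where "\<nu>1 = min (\<theta>1 / 3) \<theta>2"
  define m where "m = m1 * m2"
  obtain N3 :: nat where N3: "2 / \<mu> < real N3" using reals_Archimedean2 by blast
  \<comment> \<open>2 makes \<open>n\<close> at least \<open>N / 3\<close>, \<open>m\<close> leaves
    room to enlarge the family to exactly \<open>m\<close> pairs, \<open>N2\<close> is the threshold
    for splitting, and \<open>N3\<close> ensures \<open>2 / \<mu> \<le> N\<close> for
    \<open>separated_halves\<close>.\<close>
  define N0 where "N0 = max (max 2 m) (max N2 N3)"
  have main: "\<exists>R. R \<subseteq> perms N \<times> half_subsets N \<and> card R = m \<and>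
       (\<forall>w \<in> Incomp0 N \<delta> \<rho>. \<forall>v \<in> Incomp0 N \<delta> \<rho>. \<exists>(\<sigma>, S) \<in> R.
          I_event N \<nu>1 (c/8) w \<sigma> \<and> J_event N \<nu>1 (c/8) (8/c) v S)" if N: "N0 \<le> N" for N
  proof -
    define n where "n = N div 2"
    have "2 \<le> N" "m \<le> N" "N2 \<le> N" "N3 \<le> N" using N by (auto simp: N0_def)
    then have "0 < n" "N \<le> 3 * n" "n \<le> N" unfolding n_def by auto
    then have n: "0 < n" "real N / 3 \<le> real n" "real n \<le> real N" "2 / \<mu> \<le> real N"
      using N3 \<open>N3 \<le> N\<close> by auto
    obtain F1 where F1: "F1 \<subseteq> perms n" "finite F1" "card F1 \<le> m1" "expanding n (\<mu> / 4) \<theta>1 F1"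
      using perm_family[OF n(1)] by blast
    obtain F2 where F2: "F2 \<subseteq> half_subsets N" "finite F2" "card F2 \<le> m2" "splitting N \<mu> \<theta>2 F2"
      using set_family[OF \<open>N2 \<le> N\<close>] by blast
    have "\<exists>\<sigma>. \<sigma> \<in> perms N \<and> (\<forall>j\<in>{1..n}. \<sigma> (2 * j - 1) = j \<and> \<sigma> (2 * j) = n + \<pi> j)"
      if "\<pi> \<in> F1" for \<pi>
    proof -
      have "\<pi> permutes {1..n}" using that F1(1) by (auto simp: perms_def)
      then obtain \<sigma> where "\<sigma> \<in> perms N" "\<And>j. j \<in> {1..n} \<Longrightarrow> \<sigma> (2 * j - 1) = j"
        "\<And>j. j \<in> {1..n} \<Longrightarrow> \<sigma> (2 * j) = n + \<pi> j"
        using interleaving_permutation[OF _ n_def] by blast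
      then show ?thesis by blast
    qed
    then obtain g where g_all: "\<And>\<pi>. \<pi> \<in> F1 \<Longrightarrow>
        g \<pi> \<in> perms N \<and> (\<forall>j\<in>{1..n}. g \<pi> (2 * j - 1) = j \<and> g \<pi> (2 * j) = n + \<pi> j)"
      by metis
    then have g: "\<And>\<pi>. \<pi> \<in> F1 \<Longrightarrow> g \<pi> \<in> perms N"
      "\<And>\<pi> j. \<pi> \<in> F1 \<Longrightarrow> j \<in> {1..n} \<Longrightarrow> g \<pi> (2 * j - 1) = j"
      "\<And>\<pi> j. \<pi> \<in> F1 \<Longrightarrow> j \<in> {1..n} \<Longrightarrow> g \<pi> (2 * j) = n + \<pi> j"
      by blast+
    have I: "\<exists>\<sigma>\<in>g ` F1. I_event N \<nu>1 (c/8) w \<sigma>" if w: "w \<in> Incomp0 N \<delta> \<rho>" for w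
    proof -
      have pos: "\<mu> * real N \<le> real (card {i \<in> {1..N}. c/8 \<le> w i * sqrt (real N)})"
        using Incomp0_moderate_entries(1)[OF w assms(1,3)] unfolding c_def[symmetric] \<mu>_def
        by (rule order_trans) (auto intro!: card_mono)
      have neg: "\<mu> * real N \<le> real (card {i \<in> {1..N}. w i * sqrt (real N) \<le> - (c/8)})"
        using Incomp0_moderate_entries(2)[OF w assms(1,3)] unfolding c_def[symmetric] \<mu>_def
        by (rule order_trans) (auto intro!: card_mono)
      obtain X Y where XY: "X \<subseteq> {1..n}" "Y \<subseteq> {1..n}"
        "\<mu> / 4 * real N \<le> real (card X)" "\<mu> / 4 * real N \<le> real (card Y)"
        and sep: "\<And>i j. i \<in> X \<Longrightarrow> j \<in> Y \<Longrightarrow> c/8 \<le> \<bar>w i * sqrt (real N) - w (n + j) * sqrt (real N)\<bar>"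
        using separated_halves[OF n_def \<mu> n(4) _ pos neg] c by auto
      \<comment> \<open>The sets \<open>X\<close>, \<open>Y\<close> are dense relative to
        \<open>N\<close>, hence also relative to \<open>n\<close>, as \<open>expanding\<close>
        demands.\<close>
      have "\<mu> / 4 * real n \<le> \<mu> / 4 * real N" using n(3) \<mu>(1) by (intro mult_left_mono) auto
      then obtain \<pi> where \<pi>: "\<pi> \<in> F1" "\<theta>1 * real n \<le> real (card {x \<in> X. \<pi> x \<in> Y})"
        using F1(4)[unfolded expanding_def, rule_format, OF XY(1,2)] XY(3,4) by auto
      have "\<nu>1 * real N \<le> \<theta>1 / 3 * real N" by (intro mult_right_mono) (auto simp: \<nu>1_def)
      also have "\<dots> \<le> \<theta>1 * real n" using mult_left_mono[OF n(2), of \<theta>1] \<theta>1 by simp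
      finally have "\<nu>1 * real N \<le> real (card {x \<in> X. \<pi> x \<in> Y})" using \<pi>(2) by linarith
      moreover have "c/8 \<le> \<bar>w i - w (n + j)\<bar> * sqrt (real N)" if "i \<in> X" "j \<in> Y" for i j
        using sep[OF that] by (simp add: left_diff_distrib[symmetric] abs_mult)
      ultimately have "I_event N \<nu>1 (c/8) w (g \<pi>)"
        using I_event_interleaving[OF n_def g(2,3)[OF \<pi>(1)] XY(1)] by blast
      then show ?thesis using \<pi>(1) by blast
    qed
    have J: "\<exists>S\<in>F2. J_event N \<nu>1 (c/8) (8/c) v S" if v: "v \<in> Incomp0 N \<delta> \<rho>" for v
    proof -
      define A where "A = {i \<in> {1..N}. v i * sqrt (real N) \<in> {c/8..8/c}}"
      define B where "B = {i \<in> {1..N}. v i * sqrt (real N) \<in> {-(8/c)..-(c/8)}}"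
      have AB: "A \<subseteq> {1..N}" "B \<subseteq> {1..N}" by (auto simp: A_def B_def)
      have "\<mu> * real N \<le> real (card A)" "\<mu> * real N \<le> real (card B)"
        using Incomp0_moderate_entries[OF v assms(1,3)]
        unfolding c_def[symmetric] \<mu>_def A_def B_def by blast+
      then obtain S where S: "S \<in> F2"
        "\<theta>2 * real N \<le> real (card (A \<inter> S))" "\<theta>2 * real N \<le> real (card (A - S))"
        "\<theta>2 * real N \<le> real (card (B \<inter> S))" "\<theta>2 * real N \<le> real (card (B - S))"
        using F2(4)[unfolded splitting_def, rule_format, OF AB] by auto
      have "S \<subseteq> {1..N}" using S(1) F2(1) by (auto simp: half_subsets_def)
      then have eqs: "{i \<in> S. v i * sqrt (real N) \<in> {c/8..8/c}} = A \<inter> S"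
        "{j \<in> {1..N} - S. v j * sqrt (real N) \<in> {c/8..8/c}} = A - S"
        "{i \<in> S. v i * sqrt (real N) \<in> {-(8/c)..-(c/8)}} = B \<inter> S"
        "{j \<in> {1..N} - S. v j * sqrt (real N) \<in> {-(8/c)..-(c/8)}} = B - S"
        by (auto simp: A_def B_def)
      have "\<nu>1 * real N \<le> \<theta>2 * real N" by (intro mult_right_mono) (auto simp: \<nu>1_def)
      then have "J_event N \<nu>1 (c/8) (8/c) v S"
        using S(2-5) unfolding J_event_def eqs by linarith
      then show ?thesis using S(1) by blast
    qed
    \<comment> \<open>The choice of \<open>\<sigma>\<close> depends on \<open>w\<close> alone and
      that of \<open>S\<close> on \<open>v\<close> alone, so the product of the two families serves
      every pair.\<close>
    define R0 where "R0 = (g ` F1) \<times> F2"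
    have "finite (half_subsets N)"
      by (rule finite_subset[of _ "Pow {1..N}"]) (auto simp: half_subsets_def)
    then have fin: "finite (perms N \<times> half_subsets N)" by (simp add: perms_def finite_permutations)
    have "half_subsets N \<noteq> {}"
      using obtain_subset_with_card_n[of "N div 2" "{1..N}"] by (auto simp: half_subsets_def)
    then have "1 \<le> card (half_subsets N)"
      using \<open>finite (half_subsets N)\<close> by (simp add: Suc_le_eq card_gt_0_iff)
    moreover have "card (perms N) = fact N" by (simp add: perms_def card_permutations)
    ultimately have "fact N \<le> card (perms N \<times> half_subsets N)" by (simp add: card_cartesian_product)
    \<comment> \<open>Since \<open>fact N \<ge> N \<ge> m\<close>, enough pairs exist to pad
      \<open>R0\<close> to size exactly \<open>m\<close>; extra members do no harm to an existence
      claim.\<close>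
    then have "m \<le> card (perms N \<times> half_subsets N)"
      using \<open>m \<le> N\<close> fact_ge_self[of N] by linarith
    moreover have "R0 \<subseteq> perms N \<times> half_subsets N" using g(1) F2(1) by (auto simp: R0_def)
    moreover have "card R0 \<le> m"
      unfolding R0_def m_def card_cartesian_product
      using card_image_le[OF F1(2), of g] F1(3) F2(3) by (intro mult_le_mono) linarith+
    ultimately obtain R where R: "R0 \<subseteq> R" "R \<subseteq> perms N \<times> half_subsets N" "card R = m"
      using exists_subset_between[OF _ _ _ fin] by blast
    have "\<exists>(\<sigma>, S) \<in> R. I_event N \<nu>1 (c/8) w \<sigma> \<and> J_event N \<nu>1 (c/8) (8/c) v S"
      if "w \<in> Incomp0 N \<delta> \<rho>" "v \<in> Incomp0 N \<delta> \<rho>" for w v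
    proof -
      obtain \<sigma> S where "\<sigma> \<in> g ` F1" "S \<in> F2" "I_event N \<nu>1 (c/8) w \<sigma>" "J_event N \<nu>1 (c/8) (8/c) v S"
        using I[OF \<open>w \<in> _\<close>] J[OF \<open>v \<in> _\<close>] by blast
      then show ?thesis using R(1) by (auto simp: R0_def intro!: bexI[of _ "(\<sigma>, S)"])
    qed
    then show ?thesis using R(2,3) by blast
  qed
  have "0 < \<nu>1" "0 < c/8" "0 < 8/c" using \<theta>1 \<theta>2 c by (auto simp: \<nu>1_def)
  then show ?thesis using main by blast
qed

end
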